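(* For every $\varepsilon>0$ and all integers $n\ge 2$, $s\ge 1$ there exist a positive integer $m$ and a non-empty set $X\subseteq\{0,1,\dots,m-1\}^n$ such that (i) for all $i\in[n]$, $AvgDeg_i(X)\ge s(n-\varepsilon)$; (ii) there is no non-empty $Y\subseteq X$ such that $MinDeg_i(Y)\ge s+1$ for all $i\in[n]$.
   Context: For a finite set $A$, $X\subseteq A^n$ and $S=\{i_1<\dots<i_k\}\subseteq[n]$, let $X_S=\{(x_{i_1},\dots,x_{i_k}):(x_1,\dots,x_n)\in X\}$. For $i\in[n]$, $G_i(X)$ is the bipartite graph with left vertex set $A$, right vertex set $X_{[n]\setminus\{i\}}$, and an edge between $a\in A$ and $(x_1,\dots,x_{i-1},x_{i+1},\dots,x_n)$ iff $(x_1,\dots,x_{i-1},a,x_{i+1},\dots,x_n)\in X$. $MinDeg_i(X)$ is the minimum degree of a right vertex of $G_i(X)$, and $AvgDeg_i(X)=|X|/|X_{[n]\setminus\{i\}}|$. *)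

theory Defs
  imports Complex_Main "HOL-Library.FuncSet"
begin

text \<open>
  Tuples in \<open>A\<^sup>n\<close> are the extensional functions \<open>{1..n} \<rightarrow>\<^sub>E A\<close>. A tuple indexed by
  \<open>S = {i\<^sub>1 < \<dots> < i\<^sub>k}\<close> is an extensional function on \<open>S\<close>, so \<open>X\<^sub>S\<close> consists of restrictions,
  and inserting \<open>a\<close> at position \<open>i\<close> into a tuple \<open>y\<close> over \<open>{1..n} - {i}\<close> is \<open>y(i := a)\<close>.
\<close>

definition coord_proj :: "nat set \<Rightarrow> (nat \<Rightarrow> 'a) set \<Rightarrow> (nat \<Rightarrow> 'a) set" where
  "coord_proj S X = (\<lambda>x. restrict x S) ` X"

record ('l, 'r) bigraph =
  left_verts :: "'l set"
  right_verts :: "'r set"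
  bi_edges :: "('l \<times> 'r) set"

definition right_degree :: "('l, 'r) bigraph \<Rightarrow> 'r \<Rightarrow> nat" where
  "right_degree G v = card {u \<in> left_verts G. (u, v) \<in> bi_edges G}"

definition coord_graph ::
  "'a set \<Rightarrow> nat \<Rightarrow> nat \<Rightarrow> (nat \<Rightarrow> 'a) set \<Rightarrow> ('a, nat \<Rightarrow> 'a) bigraph" where
  "coord_graph A n i X =
    \<lparr> left_verts = A,
      right_verts = coord_proj ({1..n} - {i}) X,
      bi_edges = {(a, y). a \<in> A \<and> y \<in> coord_proj ({1..n} - {i}) X \<and> y(i := a) \<in> X} \<rparr>"

text \<open>Only meaningful for finite non-empty \<open>X\<close>, because of \<^const>\<open>Min\<close>.\<close>

definition MinDeg :: "'a set \<Rightarrow> nat \<Rightarrow> nat \<Rightarrow> (nat \<Rightarrow> 'a) set \<Rightarrow> nat" where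
  "MinDeg A n i X =
    Min (right_degree (coord_graph A n i X) ` right_verts (coord_graph A n i X))"

definition AvgDeg :: "nat \<Rightarrow> nat \<Rightarrow> (nat \<Rightarrow> 'a) set \<Rightarrow> real" where
  "AvgDeg n i X = real (card X) / real (card (coord_proj ({1..n} - {i}) X))"

end

theory Submission
  imports Defs "HOL-Real_Asymp.Real_Asymp"
begin

text \<open>
  Take \<open>X\<close> to be the set of lattice points of the positive orthant whose coordinate sum lies in
  \<open>[l, l + n s)\<close>, where \<open>l\<close> is a multiple of \<open>s\<close>. A projection of \<open>X\<close> along a coordinate is no larger
  than the set of points of sum \<open>l + n s\<close>, while \<open>X\<close> consists of \<open>n s\<close> such level sets that are
  barely smaller when \<open>l\<close> is large: hence the average degrees. Now cut the range of sums into \<open>n\<close>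
  blocks of length \<open>s\<close> and assign direction \<open>i\<close> to the \<open>i\<close>-th block. A convex function of the
  sum, with a different slope on each block, minus a linear functional is a potential that
  strictly increases whenever a point of block \<open>i\<close> is moved in direction \<open>i\<close> into another block.
  Hence a point of \<open>Y\<close> of maximal potential, say in block \<open>i\<close>, has a line in direction \<open>i\<close> that
  meets \<open>Y\<close> in block \<open>i\<close> only, that is, in at most \<open>s\<close> points.
\<close>

lemma sum_fun_upd:
  fixes x :: "'i \<Rightarrow> 'a::comm_monoid_add"
  assumes "finite I" and "i \<in> I"
  shows "sum (x(i := a)) I = a + sum x (I - {i})"
  using assms by (simp add: sum.remove[of I i])

definition sum_slab :: "'i set \<Rightarrow> nat set \<Rightarrow> ('i \<Rightarrow> nat) set" where
  "sum_slab I U = {x \<in> extensional I. sum x I \<in> U}"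

lemma sum_slab_subset_PiE:
  assumes "finite I" and "U \<subseteq> {0..<m}"
  shows "sum_slab I U \<subseteq> I \<rightarrow>\<^sub>E {0..<m}"
proof (intro subsetI PiE_I)
  fix x i assume "x \<in> sum_slab I U" and "i \<in> I"
  then have "x i \<le> sum x I" and "sum x I < m"
    using assms by (auto simp: sum_slab_def intro: member_le_sum)
  then show "x i \<in> {0..<m}" by simp
qed (auto simp: sum_slab_def extensional_def)

lemma finite_sum_slab:
  assumes "finite I" and "finite U"
  shows "finite (sum_slab I U)"
proof -
  obtain m where "U \<subseteq> {0..<m}"
    using \<open>finite U\<close> by (force simp: finite_nat_set_iff_bounded)
  then have "sum_slab I U \<subseteq> I \<rightarrow>\<^sub>E {0..<m}"
    by (rule sum_slab_subset_PiE[OF \<open>finite I\<close>])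
  then show ?thesis
    using \<open>finite I\<close> by (simp add: finite_PiE finite_subset)
qed

lemma sum_slab_nonempty:
  assumes "finite I" and "I \<noteq> {}" and "U \<noteq> {}"
  shows "sum_slab I U \<noteq> {}"
proof -
  obtain i u where "i \<in> I" and "u \<in> U" using assms by blast
  then have "sum ((restrict (\<lambda>_. 0) I)(i := u)) I = u"
    using \<open>finite I\<close> by (simp add: sum_fun_upd del: fun_upd_apply)
  then have "(restrict (\<lambda>_. 0) I)(i := u) \<in> sum_slab I U"
    using \<open>i \<in> I\<close> \<open>u \<in> U\<close> unfolding sum_slab_def by (auto simp: extensional_def)
  then show ?thesis by blast
qed

lemma card_sum_slab_eq_sum:
  assumes "finite I" and "finite U"
  shows "card (sum_slab I U) = (\<Sum>u\<in>U. card (sum_slab I {u}))"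
proof -
  have "sum_slab I U = (\<Union>u\<in>U. sum_slab I {u})"
    by (auto simp: sum_slab_def)
  then show ?thesis
    using assms by (auto simp: finite_sum_slab intro!: card_UN_disjoint) (auto simp: sum_slab_def)
qed

lemma bij_betw_restrict_sum_slab:
  assumes "finite I" and "i \<notin> I"
  shows "bij_betw (\<lambda>x. restrict x I) (sum_slab (insert i I) {t}) (sum_slab I {..t})"
proof (rule bij_betwI[where g = "\<lambda>y. y(i := t - sum y I)"])
  show "(\<lambda>x. restrict x I) \<in> sum_slab (insert i I) {t} \<rightarrow> sum_slab I {..t}"
    using assms by (auto simp: sum_slab_def)
  show "(\<lambda>y. y(i := t - sum y I)) \<in> sum_slab I {..t} \<rightarrow> sum_slab (insert i I) {t}"
  proof
    fix y assume y: "y \<in> sum_slab I {..t}"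
    then have "sum (y(i := t - sum y I)) (insert i I) = t"
      using assms by (subst sum_fun_upd) (auto simp: sum_slab_def)
    then show "y(i := t - sum y I) \<in> sum_slab (insert i I) {t}"
      using y by (auto simp: sum_slab_def extensional_def)
  qed
  show "(restrict x I)(i := t - sum (restrict x I) I) = x"
    if "x \<in> sum_slab (insert i I) {t}" for x
    using that assms by (auto simp: sum_slab_def fun_eq_iff extensional_def)
  show "restrict (y(i := t - sum y I)) I = y" if "y \<in> sum_slab I {..t}" for y
    using that assms by (simp add: sum_slab_def extensional_restrict)
qed

lemma card_sum_slab_insert_singleton:
  assumes "finite I" and "i \<notin> I"
  shows "card (sum_slab (insert i I) {t}) = card (sum_slab I {..t})"
  by (rule bij_betw_same_card[OF bij_betw_restrict_sum_slab[OF assms]])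

lemma card_sum_slab_atMost:
  fixes I :: "'i set"
  assumes "finite I"
  shows "card (sum_slab I {..t}) = (card I + t) choose card I"
  using assms
proof (induction I arbitrary: t)
  case empty
  have "sum_slab ({} :: 'i set) {..t} = {\<lambda>_. undefined}"
    by (auto simp: sum_slab_def)
  then show ?case by simp
next
  case (insert i I)
  have "card (sum_slab (insert i I) {..t}) = (\<Sum>u\<le>t. card (sum_slab I {..u}))"
    using insert.hyps
    by (simp add: card_sum_slab_eq_sum[of "insert i I"] card_sum_slab_insert_singleton)
  also have "\<dots> = Suc (card I + t) choose Suc (card I)"
    using choose_rising_sum(1)[of "card I" t] by (simp add: insert.IH)
  finally show ?case using insert.hyps by simp
qed

lemma card_sum_slab_insert_ge:
  assumes "finite I" and "i \<notin> I" and "finite U" and "U \<subseteq> {l..}"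
  shows "card U * ((card I + l) choose card I) \<le> card (sum_slab (insert i I) U)"
proof -
  have "card (sum_slab I {..l}) \<le> card (sum_slab I {..u})" if "u \<in> U" for u
    using that assms by (intro card_mono finite_sum_slab) (auto simp: sum_slab_def)
  then have "card U * card (sum_slab I {..l}) \<le> (\<Sum>u\<in>U. card (sum_slab I {..u}))"
    by (metis sum_bounded_below of_nat_id)
  then show ?thesis
    using assms by (simp add: card_sum_slab_atMost card_sum_slab_eq_sum[of "insert i I"]
        card_sum_slab_insert_singleton)
qed

lemma card_coord_proj_sum_slab_le:
  assumes "finite I" and "i \<notin> I" and "U \<subseteq> {..h}"
  shows "card (coord_proj I (sum_slab (insert i I) U)) \<le> (card I + h) choose card I"
proof -
  have "coord_proj I (sum_slab (insert i I) U) \<subseteq> sum_slab I {..h}"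
    using assms by (fastforce simp: coord_proj_def sum_slab_def)
  then show ?thesis
    using assms by (metis card_mono card_sum_slab_atMost finite_atMost finite_sum_slab)
qed

lemma AvgDeg_sum_slab_ge:
  assumes i: "i \<in> {1..n}" and U: "U \<noteq> {}" "U \<subseteq> {l..h}"
  shows "real (card U) * (real ((n - 1 + l) choose (n - 1)) / real ((n - 1 + h) choose (n - 1)))
    \<le> AvgDeg n i (sum_slab {1..n} U)"
proof -
  let ?I = "{1..n} - {i}" and ?X = "sum_slab {1..n} U"
  have I: "insert i ?I = {1..n}" "card ?I = n - 1" using i by auto
  have "finite U" using U(2) finite_subset by blast
  have "card U * ((n - 1 + l) choose (n - 1)) \<le> card ?X"
    using card_sum_slab_insert_ge[of ?I i U l] I \<open>finite U\<close> U(2) by (simp add: subset_eq)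
  then have card_ge: "real (card U) * real ((n - 1 + l) choose (n - 1)) \<le> real (card ?X)"
    by (metis of_nat_le_iff of_nat_mult)
  have card_proj_le: "card (coord_proj ?I ?X) \<le> (n - 1 + h) choose (n - 1)"
    using card_coord_proj_sum_slab_le[of ?I i U h] I U(2) by (simp add: subset_eq)
  have "?X \<noteq> {}" and "finite ?X"
    using i U(1) \<open>finite U\<close> by (auto simp: sum_slab_nonempty finite_sum_slab)
  then have "card (coord_proj ?I ?X) > 0"
    by (simp add: coord_proj_def card_gt_0_iff)
  then show ?thesis
    using card_ge card_proj_le unfolding AvgDeg_def times_divide_eq_right by (intro frac_le) auto
qed

lemma binomial_shift_ratio_tendsto_1:
  "(\<lambda>t. real ((d + t) choose d) / real ((d + (t + K)) choose d)) \<longlonglongrightarrow> 1"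
proof (induction d)
  case 0
  then show ?case by simp
next
  case (Suc d)
  have absorption: "real ((Suc d + t) choose Suc d)
      = real (Suc d + t) / real (Suc d) * real ((d + t) choose d)" for t
    using arg_cong[OF Suc_times_binomial[of d "d + t"], of real]
    by (simp add: field_simps del: binomial_Suc_Suc)
  have "(\<lambda>t. real (Suc d + t) / real (Suc d + (t + K))) \<longlonglongrightarrow> 1"
    by simp real_asymp
  from tendsto_mult[OF this Suc.IH] show ?case
    unfolding absorption by simp
qed

lemma eventually_AvgDeg_sum_slab_gt:
  fixes c :: real
  assumes "K > 0" and "c < real K"
  shows "\<forall>\<^sub>F l in sequentially. \<forall>i\<in>{1..n}. c < AvgDeg n i (sum_slab {1..n} {l..<l + K})"
proof -
  let ?ratio = "\<lambda>l. real ((n - 1 + l) choose (n - 1)) / real ((n - 1 + (l + K)) choose (n - 1))"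
  have "(\<lambda>l. real K * ?ratio l) \<longlonglongrightarrow> real K * 1"
    by (intro tendsto_mult_left binomial_shift_ratio_tendsto_1)
  then have "\<forall>\<^sub>F l in sequentially. c < real K * ?ratio l"
    using \<open>c < real K\<close> by (simp add: order_tendstoD(1))
  then show ?thesis
  proof eventually_elim
    case (elim l)
    have "real K * ?ratio l \<le> AvgDeg n i (sum_slab {1..n} {l..<l + K})" if "i \<in> {1..n}" for i
      using AvgDeg_sum_slab_ge[OF that, of "{l..<l + K}" l "l + K"] \<open>K > 0\<close>
      by (simp add: subset_eq)
    with elim show ?case by (auto intro: less_le_trans)
  qed
qed

text \<open>
  Twice the trapezoidal rule for \<open>g\<close>. With summands \<open>2 g j\<close> instead, the supporting line at \<open>u\<close>
  would still meet the graph at the first point beyond the interval around \<open>u\<close> on which \<open>g\<close> is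
  constant.
\<close>

definition trapezoid_sum :: "(nat \<Rightarrow> 'a::comm_monoid_add) \<Rightarrow> nat \<Rightarrow> 'a" where
  "trapezoid_sum g u = (\<Sum>j<u. g j + g (Suc j))"

lemma trapezoid_sum_diff:
  fixes g :: "nat \<Rightarrow> 'a::ab_group_add"
  assumes "u \<le> v"
  shows "trapezoid_sum g v - trapezoid_sum g u = (\<Sum>j=u..<v. g j + g (Suc j))"
  using sum_diff_nat_ivl[of 0 u v "\<lambda>j. g j + g (Suc j)"] assms
  by (simp add: trapezoid_sum_def atLeast0LessThan)

lemma trapezoid_sum_supporting_line:
  fixes g :: "nat \<Rightarrow> 'a::linordered_idom"
  assumes "mono g" and "g u \<noteq> g v"
  shows "trapezoid_sum g u + 2 * g u * (of_nat v - of_nat u) < trapezoid_sum g v"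
proof (cases u v rule: linorder_cases)
  case less
  have "2 * g u * (of_nat v - of_nat u) = (\<Sum>j=u..<v. g u + g u)"
    using less by (simp add: algebra_simps)
  also have "\<dots> < (\<Sum>j=u..<v. g j + g (Suc j))"
  proof (rule sum_strict_mono_ex1)
    show "\<forall>j\<in>{u..<v}. g u + g u \<le> g j + g (Suc j)"
      by (intro ballI add_mono monoD[OF \<open>mono g\<close>]) auto
    have "g u < g v" using assms less by (simp add: mono_def order_less_le)
    then show "\<exists>j\<in>{u..<v}. g u + g u < g j + g (Suc j)"
      using less by (intro bexI[of _ "v - 1"] add_le_less_mono monoD[OF \<open>mono g\<close>]) auto
  qed simp
  also have "\<dots> = trapezoid_sum g v - trapezoid_sum g u"
    using less by (simp add: trapezoid_sum_diff)
  finally show ?thesis by (simp add: algebra_simps)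
next
  case greater
  have "trapezoid_sum g u - trapezoid_sum g v = (\<Sum>j=v..<u. g j + g (Suc j))"
    using greater by (simp add: trapezoid_sum_diff)
  also have "\<dots> < (\<Sum>j=v..<u. g u + g u)"
  proof (rule sum_strict_mono_ex1)
    show "\<forall>j\<in>{v..<u}. g j + g (Suc j) \<le> g u + g u"
      by (intro ballI add_mono monoD[OF \<open>mono g\<close>]) auto
    have "g v < g u" using assms greater by (simp add: mono_def order_less_le)
    then show "\<exists>j\<in>{v..<u}. g j + g (Suc j) < g u + g u"
      using greater by (intro bexI[of _ v] add_less_le_mono monoD[OF \<open>mono g\<close>]) auto
  qed simp
  also have "\<dots> = 2 * g u * (of_nat u - of_nat v)"
    using greater by (simp add: algebra_simps)
  finally show ?thesis by (simp add: algebra_simps)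
qed (use assms in simp)

definition potential ::
  "(nat \<Rightarrow> 'a::linordered_idom) \<Rightarrow> ('i \<Rightarrow> 'a) \<Rightarrow> 'i set \<Rightarrow> ('i \<Rightarrow> nat) \<Rightarrow> 'a" where
  "potential g c I x = trapezoid_sum g (sum x I) - 2 * (\<Sum>k\<in>I. c k * of_nat (x k))"

lemma potential_less_fun_upd:
  fixes g :: "nat \<Rightarrow> 'a::linordered_idom"
  assumes I: "finite I" "i \<in> I" and "mono g" and slope: "c i = g (sum x I)"
    and "g (sum x I) \<noteq> g (sum (x(i := a)) I)"
  shows "potential g c I x < potential g c I (x(i := a))"
proof -
  let ?u = "sum x I" and ?v = "sum (x(i := a)) I"
  have sum_diff: "of_nat ?v - of_nat ?u = (of_nat a - of_nat (x i) :: 'a)"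
    using I by (simp add: sum.remove[of I i])
  have weighted_sum_diff:
    "(\<Sum>k\<in>I. c k * of_nat ((x(i := a)) k)) - (\<Sum>k\<in>I. c k * of_nat (x k))
      = g ?u * (of_nat a - of_nat (x i))"
    unfolding slope[symmetric] using I by (simp add: sum.remove[of I i] right_diff_distrib)
  have "trapezoid_sum g ?u + 2 * g ?u * (of_nat a - of_nat (x i)) < trapezoid_sum g ?v"
    using trapezoid_sum_supporting_line[OF assms(3,5)] by (simp only: sum_diff)
  then show ?thesis
    using weighted_sum_diff unfolding potential_def by (simp add: algebra_simps)
qed

lemma ex_line_within_block:
  fixes g :: "nat \<Rightarrow> 'a::linordered_idom" and Y :: "('i \<Rightarrow> nat) set"
  assumes "finite I" and "mono g" and "finite Y" and "Y \<noteq> {}"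
    and blocks: "\<And>x. x \<in> Y \<Longrightarrow> g (sum x I) \<in> c ` I"
  obtains x i where "x \<in> Y" and "i \<in> I"
    and "\<And>a. x(i := a) \<in> Y \<Longrightarrow> g (sum (x(i := a)) I) = g (sum x I)"
proof -
  obtain x where x: "x \<in> Y" and "Max (potential g c I ` Y) = potential g c I x"
    using obtains_MAX[OF \<open>finite Y\<close> \<open>Y \<noteq> {}\<close>] .
  then have max: "potential g c I y \<le> potential g c I x" if "y \<in> Y" for y
    using that \<open>finite Y\<close> by (metis Max_ge finite_imageI imageI)
  obtain i where i: "i \<in> I" "c i = g (sum x I)" using blocks[OF x] by auto
  have "g (sum (x(i := a)) I) = g (sum x I)" if "x(i := a) \<in> Y" for a
    using potential_less_fun_upd[of I i g c x a] assms(1,2) i max[OF that] by fastforce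
  with that x i show ?thesis by blast
qed

lemma MinDeg_le_card_line:
  assumes "finite X" and "x \<in> X" and "x \<in> extensional {1..n}" and "i \<in> {1..n}"
  shows "MinDeg A n i X \<le> card {a \<in> A. x(i := a) \<in> X}"
proof -
  let ?G = "coord_graph A n i X" and ?y = "restrict x ({1..n} - {i})"
  have y: "?y \<in> right_verts ?G" and fin: "finite (right_verts ?G)"
    using assms by (auto simp: coord_graph_def coord_proj_def)
  have "?y(i := a) = x(i := a)" for a
    using assms by (auto simp: extensional_def)
  then have "right_degree ?G ?y = card {a \<in> A. x(i := a) \<in> X}"
    using y by (simp add: right_degree_def coord_graph_def del: restrict_upd)
  moreover have "MinDeg A n i X \<le> right_degree ?G ?y"
    unfolding MinDeg_def using y fin by (intro Min_le finite_imageI imageI)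
  ultimately show ?thesis by simp
qed

lemma MinDeg_le_card_line_sums:
  fixes X :: "(nat \<Rightarrow> 'a::cancel_comm_monoid_add) set"
  assumes "finite X" and "x \<in> X" and "x \<in> extensional {1..n}" and "i \<in> {1..n}"
    and "finite V" and "\<And>a. x(i := a) \<in> X \<Longrightarrow> sum (x(i := a)) {1..n} \<in> V"
  shows "MinDeg A n i X \<le> card V"
proof -
  have "MinDeg A n i X \<le> card {a \<in> A. x(i := a) \<in> X}"
    using assms by (intro MinDeg_le_card_line)
  also have "\<dots> \<le> card V"
  proof (rule card_inj_on_le)
    show "inj_on (\<lambda>a. sum (x(i := a)) {1..n}) {a \<in> A. x(i := a) \<in> X}"
      using \<open>i \<in> {1..n}\<close> by (simp add: inj_on_def sum_fun_upd del: fun_upd_apply)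
  qed (use assms in auto)
  finally show ?thesis .
qed

lemma ex_MinDeg_le_if_subset_sum_slab:
  assumes "s > 0" and Y: "Y \<noteq> {}" "Y \<subseteq> sum_slab {1..n} {k * s..<k * s + n * s}"
  shows "\<exists>i\<in>{1..n}. MinDeg A n i Y \<le> s"
proof -
  have "finite Y" by (rule finite_subset[OF Y(2)]) (simp add: finite_sum_slab)
  have blocks: "int (sum x {1..n} div s) \<in> (\<lambda>i. int (k + i) - 1) ` {1..n}"
    if "x \<in> Y" for x
  proof -
    have "k \<le> sum x {1..n} div s" and "sum x {1..n} div s < k + n"
      using that Y(2) \<open>s > 0\<close>
      by (auto simp: sum_slab_def less_eq_div_iff_mult_less_eq div_less_iff_less_mult
          add_mult_distrib)
    then show ?thesis by (intro image_eqI[of _ _ "sum x {1..n} div s - k + 1"]) auto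
  qed
  have "mono (\<lambda>u. int (u div s))" by (simp add: mono_def div_le_mono)
  then obtain x i where x: "x \<in> Y" and i: "i \<in> {1..n}"
    and "\<And>a. x(i := a) \<in> Y \<Longrightarrow> int (sum (x(i := a)) {1..n} div s) = int (sum x {1..n} div s)"
    using ex_line_within_block[where g = "\<lambda>u. int (u div s)"
        and c = "\<lambda>i. int (k + i) - 1", OF finite_atLeastAtMost _ \<open>finite Y\<close> Y(1) blocks]
    by blast
  then have line: "sum (x(i := a)) {1..n} div s = sum x {1..n} div s" if "x(i := a) \<in> Y" for a
    using that by (simp only: of_nat_eq_iff)
  define b where "b = sum x {1..n} div s"
  have "MinDeg A n i Y \<le> card {b * s..<Suc b * s}"
  proof (rule MinDeg_le_card_line_sums)
    show "x \<in> extensional {1..n}" using x Y(2) by (auto simp: sum_slab_def)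
    show "sum (x(i := a)) {1..n} \<in> {b * s..<Suc b * s}" if "x(i := a) \<in> Y" for a
      using \<open>s > 0\<close> unfolding b_def line[OF that, symmetric]
      by (simp add: dividend_less_div_times del: fun_upd_apply)
  qed (use \<open>finite Y\<close> x i in simp_all)
  also have "\<dots> = s" by simp
  finally show ?thesis using i by blast
qed

theorem theorem3:
  fixes \<epsilon> :: real and n s :: nat
  assumes "\<epsilon> > 0" and "n \<ge> 2" and "s \<ge> 1"
  shows "\<exists>(m::nat) (X :: (nat \<Rightarrow> nat) set).
           m > 0 \<and> X \<noteq> {} \<and> X \<subseteq> ({1..n} \<rightarrow>\<^sub>E {0..<m}) \<and>
           (\<forall>i\<in>{1..n}. AvgDeg n i X \<ge> real s * (real n - \<epsilon>)) \<and>
           \<not> (\<exists>Y. Y \<noteq> {} \<and> Y \<subseteq> X \<and> (\<forall>i\<in>{1..n}. MinDeg {0..<m} n i Y \<ge> s + 1))"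
proof -
  have "real s * (real n - \<epsilon>) < real (n * s)" and "n * s > 0"
    using assms by (simp_all add: algebra_simps)
  then obtain q where avg: "\<And>l i. l \<ge> q \<Longrightarrow> i \<in> {1..n} \<Longrightarrow>
      real s * (real n - \<epsilon>) < AvgDeg n i (sum_slab {1..n} {l..<l + n * s})"
    using eventually_AvgDeg_sum_slab_gt[of "n * s"] unfolding eventually_sequentially by meson
  define l where "l = q * s"
  have "l \<ge> q" using assms by (simp add: l_def)
  let ?X = "sum_slab {1..n} {l..<l + n * s}"
  have peel: "\<exists>i\<in>{1..n}. MinDeg A n i Y \<le> s"
    if "Y \<noteq> {}" and "Y \<subseteq> ?X" for A Y
    using that assms unfolding l_def by (intro ex_MinDeg_le_if_subset_sum_slab) auto
  show ?thesis
  proof (intro exI conjI ballI)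
    show "l + n * s > 0" using \<open>n * s > 0\<close> by simp
    show "?X \<noteq> {}" using \<open>n * s > 0\<close> by (intro sum_slab_nonempty) auto
    show "?X \<subseteq> {1..n} \<rightarrow>\<^sub>E {0..<l + n * s}" by (intro sum_slab_subset_PiE) auto
    show "\<not> (\<exists>Y. Y \<noteq> {} \<and> Y \<subseteq> ?X \<and> (\<forall>i\<in>{1..n}. MinDeg {0..<l + n * s} n i Y \<ge> s + 1))"
      using peel by (metis Suc_eq_plus1 not_less_eq_eq)
  qed (use avg[OF \<open>l \<ge> q\<close>] in \<open>rule less_imp_le\<close>)
qed

end
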